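(* The largest $k\in\mathbb N$ for which there exists an integer $n\ge0$ such that the sequence $R(n),R(n+1),\dots,R(n+k)$ is increasing (in the weak sense, $R(n)\le R(n+1)\le\cdots\le R(n+k)$) is $k=3$. Moreover, for $k=3$ this occurs uniquely at $n=0$: $R(0)\le R(1)\le R(2)\le R(3)$, and there is no integer $n\ge1$ with $R(n)\le R(n+1)\le R(n+2)\le R(n+3)$.
   Context: Fibonacci numbers: $F_1=F_2=1$, $F_{m+2}=F_{m+1}+F_m$. For an integer $n\ge0$, $R(n)$ is the number of ways of writing $n$ as a sum of distinct Fibonacci numbers (i.e. the number of finite subsets $S\subset\{2,3,4,\dots\}$ with $\sum_{i\in S}F_i=n$; $R(0)=1$). *)

theory Defs
  imports Main "HOL-Number_Theory.Fib"
begin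

text \<open>The library's \<^const>\<open>fib\<close> satisfies \<open>fib 1 = fib 2 = 1\<close>; index sets start at 2, so the
  value 1 is available as a summand only once.\<close>

definition fib_reps :: "nat \<Rightarrow> nat set set" where
  "fib_reps n = {S. finite S \<and> S \<subseteq> {2..} \<and> (\<Sum>i\<in>S. fib i) = n}"

definition R :: "nat \<Rightarrow> nat" where
  "R n = card (fib_reps n)"

text \<open>\<^const>\<open>card\<close> is 0 on infinite sets, so finiteness is needed for \<^const>\<open>R\<close> to be the
  intended count.\<close>

lemma le_Suc_fib: "i \<le> Suc (fib i)"
proof (induction i rule: fib.induct)
  case (3 n)
  show ?case
  proof (cases n)
    case (Suc m)
    then have "fib n \<ge> 1" using fib_neq_0_nat[of n] by linarith
    then show ?thesis using 3 by simp
  qed simp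
qed simp_all

lemma finite_fib_reps: "finite (fib_reps n)"
proof (rule finite_subset)
  show "fib_reps n \<subseteq> Pow {..Suc n}"
  proof
    fix S assume S: "S \<in> fib_reps n"
    have "i \<le> Suc n" if "i \<in> S" for i
    proof -
      have "fib i \<le> (\<Sum>i\<in>S. fib i)"
        using S that by (intro member_le_sum) (auto simp: fib_reps_def)
      then show ?thesis using S le_Suc_fib[of i] by (simp add: fib_reps_def)
    qed
    then show "S \<in> Pow {..Suc n}" by auto
  qed
qed simp

text \<open>\<open>R n \<le> R (n + 1) \<le> \<dots> \<le> R (n + k)\<close>, a run of \<open>k + 1\<close> terms\<close>

definition increasing_run :: "nat \<Rightarrow> nat \<Rightarrow> bool" where
  "increasing_run n k \<longleftrightarrow> (\<forall>i<k. R (n + i) \<le> R (n + i + 1))"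

end

theory Submission
  imports Defs
begin

text \<open>
  Raising every index of a representation of \<open>n\<close> by one gives a number that depends on \<open>n\<close> only:
  for an index set \<open>S\<close> with sum \<open>n\<close>, the sum of the \<open>F\<^bsub>i+1\<^esub>\<close> differs from \<open>\<phi>n\<close> by
  the sum of the \<open>\<psi>\<^sup>i\<close>, where \<open>\<phi>\<close> is the golden ratio and \<open>\<psi> = 1 - \<phi>\<close>, and as \<open>i \<ge> 2\<close>
  this error lies in an open interval of length one. Write \<open>\<sigma> n\<close> for the result. Let \<open>A n\<close>
  count the representations of \<open>n\<close> that avoid the summand \<open>F\<^sub>2 = 1\<close>. Shifting indices shows
  \<open>A (\<sigma> n) = R n\<close>, and \<open>A\<close> vanishes outside the range of \<open>\<sigma>\<close>.

  Removing the summand 1 gives \<open>R (k + 1) = A (k + 1) + A k\<close>. Hence \<open>R (k + 1) \<le> R (k + 2)\<close>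
  says precisely that \<open>A k \<le> A (k + 2)\<close>, so a descent occurs whenever \<open>k\<close> is in the range of
  \<open>\<sigma>\<close> and \<open>k + 2\<close> is not. The range is governed by one rule: \<open>\<sigma> (p + 1) - \<sigma> p\<close> is 2 if
  \<open>p\<close> is in the range and 1 otherwise. It follows that two consecutive numbers are never both
  outside the range, nor are three consecutive numbers ever all inside it.

  A run of four terms that starts at \<open>k + 1\<close> means \<open>A k \<le> A (k + 2)\<close>,
  \<open>A (k + 1) \<le> A (k + 3)\<close> and \<open>A (k + 2) \<le> A (k + 4)\<close>. One of \<open>k + 2\<close>, \<open>k + 3\<close>,
  \<open>k + 4\<close> is outside the range, and the inequalities propagate this downwards in steps of two
  to an alternating stretch \<open>x, x + 2, x + 4\<close> inside and \<open>x + 1, x + 3\<close> outside. There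
  \<open>\<sigma>\<close> has two successive increments of 2, say \<open>x = \<sigma> p\<close>, so \<open>p\<close> and \<open>p + 1\<close> are in the
  range and \<open>p + 2\<close> is not. This is a descent \<open>R (p + 1) > R (p + 2)\<close>, that is
  \<open>A (x + 2) > A (x + 4)\<close>, against the assumed inequalities.
\<close>

section \<open>The index shift\<close>

definition golden :: real where
  "golden = (1 + sqrt 5) / 2"

lemma golden_square: "golden * golden = golden + 1"
  by (simp add: golden_def field_simps)

lemma golden_gt_1: "1 < golden"
  by (simp add: golden_def)

lemma golden_lt_2: "golden < 2"
proof -
  have "sqrt 5 < sqrt 9" by (simp only: real_sqrt_less_iff)
  also have "sqrt 9 = (3::real)" by (rule real_sqrt_unique) simp_all
  finally show ?thesis by (simp add: golden_def)
qed

text \<open>The strict bounds in \<open>sum_conjugate_powers_bounds\<close> below place the shifted sum in the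
  open interval of length one that ends at \<open>golden * (n + 1) - 1\<close>, hence the floor.\<close>

definition fib_shift :: "nat \<Rightarrow> nat" where
  "fib_shift n = nat (\<lfloor>golden * real (n + 1)\<rfloor> - 1)"

lemma fib_shift_floor: "int (fib_shift n) = \<lfloor>golden * real (n + 1)\<rfloor> - 1"
proof -
  have "1 * 1 \<le> golden * real (n + 1)"
    using golden_gt_1 by (intro mult_mono) auto
  then have "1 \<le> \<lfloor>golden * real (n + 1)\<rfloor>" by simp
  then show ?thesis by (simp add: fib_shift_def)
qed

lemma fib_shift_0: "fib_shift 0 = 0"
proof -
  have "\<lfloor>golden\<rfloor> = 1" using golden_gt_1 golden_lt_2 by (simp add: floor_eq_iff)
  then show ?thesis by (simp add: fib_shift_def)
qed

lemma fib_shift_Suc_cases: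
  "fib_shift (Suc n) = fib_shift n + 1 \<or> fib_shift (Suc n) = fib_shift n + 2"
proof -
  let ?x = "golden * real (n + 1)"
  have eq: "golden * real (Suc n + 1) = ?x + golden" by (simp add: algebra_simps)
  have "\<lfloor>?x\<rfloor> + 1 \<le> \<lfloor>?x + golden\<rfloor>" "\<lfloor>?x + golden\<rfloor> \<le> \<lfloor>?x\<rfloor> + 2"
    using golden_gt_1 golden_lt_2 by linarith+
  then show ?thesis
    using fib_shift_floor[of n] fib_shift_floor[of "Suc n"] unfolding eq by linarith
qed

lemma strict_mono_fib_shift: "strict_mono fib_shift"
proof (rule strict_mono_Suc_iff[THEN iffD2], rule allI)
  show "fib_shift n < fib_shift (Suc n)" for n
    using fib_shift_Suc_cases[of n] by linarith
qed

lemma fib_Suc_golden: "real (fib (Suc i)) = golden * real (fib i) + (1 - golden) ^ i"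
proof (induction i)
  case (Suc i)
  have "real (fib (Suc (Suc i))) = real (fib (Suc i)) + real (fib i)" by simp
  also have "\<dots> = golden * real (fib (Suc i)) + ((1 - golden) * real (fib (Suc i)) + real (fib i))"
    by (simp add: algebra_simps)
  also have "(1 - golden) * real (fib (Suc i)) + real (fib i)
      = real (fib i) * (1 + golden - golden * golden) + (1 - golden) ^ Suc i"
    by (simp add: Suc algebra_simps)
  finally show ?case by (simp add: golden_square)
qed simp

lemma index_set_cases:
  assumes "finite S" "S \<subseteq> {2..<Suc N}"
  obtains T where "finite T" "T \<subseteq> {2..<N}" "S = Suc ` T \<or> S = insert 2 (Suc ` T)" "2 \<notin> Suc ` T"
proof -
  define T where "T = {i. Suc i \<in> S \<and> i \<noteq> 1}"
  have sub: "T \<subseteq> {2..<N}" using assms(2) by (auto simp: T_def)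
  have img: "Suc ` T = S - {2}"
  proof
    show "S - {2} \<subseteq> Suc ` T"
    proof
      fix i assume i: "i \<in> S - {2}"
      then have "i = Suc (i - 1)" using assms(2) by auto
      moreover from this i have "i - 1 \<in> T" by (auto simp: T_def)
      ultimately show "i \<in> Suc ` T" by blast
    qed
  qed (auto simp: T_def)
  show ?thesis
  proof
    show "finite T" using sub finite_subset by blast
    show "T \<subseteq> {2..<N}" by (rule sub)
    show "S = Suc ` T \<or> S = insert 2 (Suc ` T)" "2 \<notin> Suc ` T" unfolding img by blast+
  qed
qed

text \<open>The interval is the one fixed by the splitting of an index set into a shifted index set and
  possibly 2: with \<open>\<psi> = 1 - golden < 0\<close>, the maps \<open>x \<mapsto> \<psi>x\<close> and \<open>x \<mapsto> \<psi>x + \<psi>\<^sup>2\<close> both send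
  \<open>(-\<psi>\<^sup>2, -\<psi>)\<close> into itself, because \<open>\<psi>\<^sup>2 = \<psi> + 1\<close>.\<close>

lemma sum_conjugate_powers_bounds:
  assumes "finite S" "S \<subseteq> {2..<N}"
  shows "golden - 2 < (\<Sum>i\<in>S. (1 - golden) ^ i) \<and> (\<Sum>i\<in>S. (1 - golden) ^ i) < golden - 1"
  using assms
proof (induction N arbitrary: S)
  case 0
  then have "S = {}" by auto
  then show ?case using golden_gt_1 golden_lt_2 by simp
next
  case (Suc N)
  obtain T where T: "finite T" "T \<subseteq> {2..<N}" "S = Suc ` T \<or> S = insert 2 (Suc ` T)" "2 \<notin> Suc ` T"
    using index_set_cases[OF Suc.prems] by blast
  define x where "x = (\<Sum>i\<in>T. (1 - golden) ^ i)"
  have shifted: "(\<Sum>i\<in>Suc ` T. (1 - golden) ^ i) = (1 - golden) * x"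
    by (simp add: x_def sum.reindex sum_distrib_left)
  have x: "golden - 2 < x" "x < golden - 1" using Suc.IH[OF T(1,2)] by (auto simp: x_def)
  have "(golden - 1) * x < (golden - 1) * (golden - 1)"
    "(golden - 1) * (golden - 2) < (golden - 1) * x"
    using x golden_gt_1 by (simp_all add: mult_strict_left_mono)
  then have bounds: "golden - 2 < (1 - golden) * x" "(1 - golden) * x < 2 * golden - 3"
    using golden_square by (simp_all add: algebra_simps)
  have square: "(1 - golden) ^ 2 = 2 - golden"
    using golden_square by (simp add: power2_eq_square algebra_simps)
  from T(3) show ?case
  proof
    assume "S = Suc ` T"
    then show ?thesis using shifted bounds golden_lt_2 by simp
  next
    assume "S = insert 2 (Suc ` T)"
    then have "(\<Sum>i\<in>S. (1 - golden) ^ i) = (2 - golden) + (1 - golden) * x"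
      using T(1,4) shifted square by simp
    then show ?thesis using bounds golden_lt_2 by simp
  qed
qed

text \<open>This makes the shift well defined: the right-hand side depends on \<open>S\<close> only through its
  Fibonacci sum.\<close>

lemma sum_fib_Suc:
  assumes "finite S" "S \<subseteq> {2..}"
  shows "(\<Sum>i\<in>S. fib (Suc i)) = fib_shift (\<Sum>i\<in>S. fib i)"
proof -
  let ?n = "\<Sum>i\<in>S. fib i" and ?m = "\<Sum>i\<in>S. fib (Suc i)"
  obtain N where "S \<subseteq> {..<N}" using assms(1) unfolding finite_nat_set_iff_bounded by auto
  then have "S \<subseteq> {2..<N}" using assms(2) by auto
  from sum_conjugate_powers_bounds[OF assms(1) this]
  have "golden - 2 < (\<Sum>i\<in>S. (1 - golden) ^ i)" "(\<Sum>i\<in>S. (1 - golden) ^ i) < golden - 1"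
    by auto
  moreover have "real ?m = golden * real ?n + (\<Sum>i\<in>S. (1 - golden) ^ i)"
    by (simp del: fib.simps add: fib_Suc_golden sum.distrib sum_distrib_left)
  ultimately have "\<lfloor>golden * real (?n + 1)\<rfloor> = int ?m + 1"
    by (simp add: floor_eq_iff algebra_simps)
  then have "int (fib_shift ?n) = int ?m" using fib_shift_floor[of ?n] by linarith
  then show ?thesis by (simp only: of_nat_eq_iff)
qed

lemma fib_reps_shift:
  assumes "S \<in> fib_reps n"
  shows "Suc ` S \<in> fib_reps (fib_shift n)" "2 \<notin> Suc ` S"
proof -
  from assms have S: "finite S" "S \<subseteq> {2..}" "(\<Sum>i\<in>S. fib i) = n" by (auto simp: fib_reps_def)
  have "(\<Sum>i\<in>Suc ` S. fib i) = fib_shift n"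
    using sum_fib_Suc[OF S(1,2)] S(3) by (simp add: sum.reindex del: fib.simps)
  then show "Suc ` S \<in> fib_reps (fib_shift n)" using S by (auto simp: fib_reps_def)
  show "2 \<notin> Suc ` S" using S(2) by auto
qed

lemma fib_reps_unshift:
  assumes "S \<in> fib_reps n" "2 \<notin> S"
  obtains T m where "T \<in> fib_reps m" "S = Suc ` T" "n = fib_shift m"
proof -
  from assms have S: "finite S" "S \<subseteq> {2..}" "(\<Sum>i\<in>S. fib i) = n" by (auto simp: fib_reps_def)
  obtain N where "S \<subseteq> {..<N}" using S(1) unfolding finite_nat_set_iff_bounded by auto
  then have "S \<subseteq> {2..<Suc N}" using S(2) by fastforce
  from index_set_cases[OF S(1) this]
  obtain T where T: "finite T" "T \<subseteq> {2..<N}" and "S = Suc ` T \<or> S = insert 2 (Suc ` T)"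
    by metis
  then have T: "finite T" "T \<subseteq> {2..<N}" "S = Suc ` T" using assms(2) by auto
  have mem: "T \<in> fib_reps (\<Sum>i\<in>T. fib i)" using T by (auto simp: fib_reps_def)
  from fib_reps_shift(1)[OF this] T(3) S(3)
  have "n = fib_shift (\<Sum>i\<in>T. fib i)" by (simp add: fib_reps_def)
  then show ?thesis using that mem T(3) by blast
qed

lemma insert_2_fib_reps:
  assumes "S \<in> fib_reps n" "2 \<notin> S"
  shows "insert 2 S \<in> fib_reps (Suc n)"
  using assms by (auto simp: fib_reps_def)

lemma remove_2_fib_reps:
  assumes "S \<in> fib_reps n" "2 \<in> S"
  obtains k where "n = Suc k" "S - {2} \<in> fib_reps k"
proof -
  from assms have S: "finite S" "S \<subseteq> {2..}" "(\<Sum>i\<in>S. fib i) = n" by (auto simp: fib_reps_def)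
  have "n = fib 2 + (\<Sum>i\<in>S - {2}. fib i)"
    using S(1,3) assms(2) by (simp add: sum.remove del: fib_2)
  moreover have "S - {2} \<in> fib_reps (\<Sum>i\<in>S - {2}. fib i)" using S by (auto simp: fib_reps_def)
  ultimately show ?thesis using that by simp
qed

lemma fib_shift_1: "fib_shift 1 = 2"
proof -
  have "{2} \<in> fib_reps 1" by (simp add: fib_reps_def)
  from fib_reps_shift(1)[OF this] show ?thesis by (simp add: fib_reps_def numeral_2_eq_2)
qed

lemma less_fib_shift:
  assumes "0 < n"
  shows "n < fib_shift n"
  using assms
proof (induction n rule: nat_induct_non_zero)
  case (Suc n)
  then show ?case using fib_shift_Suc_cases[of n] by linarith
qed (use fib_shift_1 in simp)

section \<open>The range of the shift\<close>

lemma in_range_or_Suc_range: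
  "n \<in> range fib_shift \<or> n \<in> Suc ` range fib_shift"
proof (induction n)
  case 0
  show ?case using fib_shift_0 by (metis rangeI)
next
  case (Suc n)
  then show ?case
  proof
    assume "n \<in> Suc ` range fib_shift"
    then obtain q where "n = Suc (fib_shift q)" by auto
    with fib_shift_Suc_cases[of q] have "n = fib_shift (Suc q) \<or> Suc n = fib_shift (Suc q)" by auto
    then show ?thesis by blast
  qed blast
qed

lemma pred_in_range:
  assumes "n \<notin> range fib_shift"
  obtains q where "n = Suc (fib_shift q)"
  using assms in_range_or_Suc_range[of n] by blast

lemma adjacent_meets_range:
  "n \<in> range fib_shift \<or> Suc n \<in> range fib_shift"
  using pred_in_range by blast

lemma fib_reps_nonempty: "fib_reps n \<noteq> {}"
proof (induction n rule: less_induct)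
  case (less n)
  consider "n = 0" | q where "0 < n" "n = fib_shift q" | q where "n = Suc (fib_shift q)"
    using in_range_or_Suc_range[of n] by auto
  then show ?case
  proof cases
    case 1
    then have "{} \<in> fib_reps n" by (simp add: fib_reps_def)
    then show ?thesis by blast
  next
    case (2 q)
    have "q \<noteq> 0" using 2 fib_shift_0 by (metis less_irrefl)
    then have "q < n" using less_fib_shift 2 by simp
    then show ?thesis using less[of q] fib_reps_shift(1) 2 by blast
  next
    case (3 q)
    have "q \<le> fib_shift q" by (rule strict_mono_imp_increasing[OF strict_mono_fib_shift])
    then have "q < n" using 3 by simp
    then obtain T where "T \<in> fib_reps q" using less by blast
    then show ?thesis using insert_2_fib_reps[OF fib_reps_shift] 3 by blast
  qed
qed

lemma fib_shift_fib_shift: "fib_shift (fib_shift n) = fib_shift n + n"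
proof -
  obtain S where S: "S \<in> fib_reps n" using fib_reps_nonempty by blast
  have inj: "inj_on (\<lambda>i. Suc (Suc i)) S" by (simp add: inj_on_def)
  have "fib_shift (fib_shift n) = (\<Sum>i\<in>Suc ` Suc ` S. fib i)"
    using fib_reps_shift(1)[OF fib_reps_shift(1)[OF S]] by (simp add: fib_reps_def)
  also have "\<dots> = (\<Sum>i\<in>S. fib (Suc i)) + (\<Sum>i\<in>S. fib i)"
    using inj by (simp add: image_image sum.reindex sum.distrib)
  also have "\<dots> = fib_shift n + n"
    using S sum_fib_Suc by (simp add: fib_reps_def)
  finally show ?thesis .
qed

text \<open>A number in the range has a representation without the summand 1; including 1 raises the
  number by 1 and its shift by \<open>F\<^sub>3 = 2\<close>.\<close>

lemma fib_shift_Suc_in_range: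
  assumes "p \<in> range fib_shift"
  shows "fib_shift (Suc p) = fib_shift p + 2"
proof -
  obtain q where q: "p = fib_shift q" using assms by blast
  obtain T where "T \<in> fib_reps q" using fib_reps_nonempty by blast
  then have S: "Suc ` T \<in> fib_reps p" "2 \<notin> Suc ` T" using fib_reps_shift q by simp_all
  define S where "S = Suc ` T"
  have fin: "finite S" "S \<subseteq> {2..}" "2 \<notin> S" "(\<Sum>i\<in>S. fib i) = p"
    using S by (auto simp: fib_reps_def S_def)
  have "fib_shift (Suc p) = (\<Sum>i\<in>insert 2 S. fib (Suc i))"
    using sum_fib_Suc[of "insert 2 S"] fin by simp
  also have "\<dots> = fib (Suc 2) + (\<Sum>i\<in>S. fib (Suc i))" using fin by simp
  also have "\<dots> = fib_shift p + 2"
    using sum_fib_Suc[of S] fin by (simp add: numeral_2_eq_2)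
  finally show ?thesis .
qed

text \<open>A number \<open>p\<close> outside the range is \<open>fib_shift q + 1\<close>, and since \<open>p\<close> is skipped,
  \<open>p + 1 = fib_shift (q + 1)\<close>. Both shifts can then be computed from
  \<open>fib_shift (fib_shift n) = fib_shift n + n\<close>.\<close>

lemma fib_shift_Suc_not_in_range:
  assumes "p \<notin> range fib_shift"
  shows "fib_shift (Suc p) = fib_shift p + 1"
proof -
  obtain q where q: "p = Suc (fib_shift q)" using assms pred_in_range by blast
  have "fib_shift (Suc q) \<noteq> p" using assms by blast
  then have Suc_p: "Suc p = fib_shift (Suc q)" using q fib_shift_Suc_cases[of q] by linarith
  have "fib_shift p = fib_shift q + q + 2"
    using q fib_shift_Suc_in_range[of "fib_shift q"] fib_shift_fib_shift[of q] by simp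
  moreover have "fib_shift (Suc p) = Suc p + Suc q"
    unfolding Suc_p by (rule fib_shift_fib_shift)
  ultimately show ?thesis using q by simp
qed

lemma fib_shift_Suc_eq:
  assumes "fib_shift p + 1 \<in> range fib_shift"
  shows "fib_shift (Suc p) = fib_shift p + 1"
proof -
  obtain q where q: "fib_shift p + 1 = fib_shift q" using assms by (rule rangeE)
  then have "fib_shift p < fib_shift q" by linarith
  then have "Suc p \<le> q" by (simp add: strict_mono_less[OF strict_mono_fib_shift])
  then have "fib_shift (Suc p) \<le> fib_shift q"
    by (simp only: strict_mono_less_eq[OF strict_mono_fib_shift])
  then show ?thesis using q fib_shift_Suc_cases[of p] by linarith
qed

text \<open>Three consecutive values would need two successive increments of 1, hence two consecutive
  arguments outside the range.\<close>

lemma no_three_consecutive_in_range: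
  assumes "n \<in> range fib_shift" "n + 1 \<in> range fib_shift"
  shows "n + 2 \<notin> range fib_shift"
proof
  assume n2: "n + 2 \<in> range fib_shift"
  obtain p where p: "n = fib_shift p" using assms(1) by (rule rangeE)
  then have Suc_p: "fib_shift (Suc p) = n + 1" using assms(2) fib_shift_Suc_eq by simp
  then have Suc_Suc_p: "fib_shift (Suc (Suc p)) = n + 2"
    using n2 fib_shift_Suc_eq[of "Suc p"] by simp
  have "p \<notin> range fib_shift" "Suc p \<notin> range fib_shift"
    using fib_shift_Suc_in_range[of p] fib_shift_Suc_in_range[of "Suc p"] p Suc_p Suc_Suc_p
    by linarith+
  then show False using adjacent_meets_range by blast
qed

section \<open>Counting representations without the summand 1\<close>

definition reps_without_1 :: "nat \<Rightarrow> nat" where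
  "reps_without_1 n = card {S \<in> fib_reps n. 2 \<notin> S}"

lemma reps_without_1_fib_shift: "reps_without_1 (fib_shift n) = R n"
proof -
  have "{S \<in> fib_reps (fib_shift n). 2 \<notin> S} = (`) Suc ` fib_reps n"
  proof
    show "{S \<in> fib_reps (fib_shift n). 2 \<notin> S} \<subseteq> (`) Suc ` fib_reps n"
    proof
      fix S assume "S \<in> {S \<in> fib_reps (fib_shift n). 2 \<notin> S}"
      then obtain T m where T: "T \<in> fib_reps m" "S = Suc ` T" "fib_shift n = fib_shift m"
        using fib_reps_unshift by blast
      then have "m = n" using strict_mono_eq[OF strict_mono_fib_shift] by simp
      then show "S \<in> (`) Suc ` fib_reps n" using T by blast
    qed
  qed (use fib_reps_shift in blast)
  moreover have "inj_on ((`) Suc) (fib_reps n)" by (simp add: inj_on_def inj_image_eq_iff)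
  ultimately show ?thesis by (simp add: reps_without_1_def R_def card_image)
qed

lemma reps_without_1_eq_0_iff: "reps_without_1 n = 0 \<longleftrightarrow> n \<notin> range fib_shift"
proof
  assume "reps_without_1 n = 0"
  then have "R m \<noteq> 0 \<Longrightarrow> n \<noteq> fib_shift m" for m using reps_without_1_fib_shift by metis
  moreover have "R m \<noteq> 0" for m by (simp add: R_def finite_fib_reps fib_reps_nonempty)
  ultimately show "n \<notin> range fib_shift" by blast
next
  assume "n \<notin> range fib_shift"
  then have "2 \<in> S" if "S \<in> fib_reps n" for S using that fib_reps_unshift by blast
  then have "{S \<in> fib_reps n. 2 \<notin> S} = {}" by blast
  then show "reps_without_1 n = 0" by (simp only: reps_without_1_def card.empty)
qed

lemma R_Suc: "R (Suc n) = reps_without_1 (Suc n) + reps_without_1 n"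
proof -
  let ?X = "{S \<in> fib_reps (Suc n). 2 \<notin> S}" and ?Y = "{S \<in> fib_reps n. 2 \<notin> S}"
  have split: "fib_reps (Suc n) = ?X \<union> insert 2 ` ?Y"
  proof
    show "fib_reps (Suc n) \<subseteq> ?X \<union> insert 2 ` ?Y"
    proof
      fix S assume S: "S \<in> fib_reps (Suc n)"
      show "S \<in> ?X \<union> insert 2 ` ?Y"
      proof (cases "2 \<in> S")
        case True
        then have "S - {2} \<in> ?Y" using remove_2_fib_reps[OF S] by blast
        moreover have "S = insert 2 (S - {2})" using True by blast
        ultimately show ?thesis by blast
      qed (use S in blast)
    qed
  qed (use insert_2_fib_reps in blast)
  have inj: "inj_on (insert 2) ?Y" by (simp add: inj_on_def insert_ident)
  have "R (Suc n) = card ?X + card (insert 2 ` ?Y)"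
    unfolding R_def by (subst split, rule card_Un_disjoint) (auto simp: finite_fib_reps)
  then show ?thesis by (simp add: reps_without_1_def card_image[OF inj])
qed

lemma R_Suc_le_iff: "R (n + 1) \<le> R (n + 2) \<longleftrightarrow> reps_without_1 n \<le> reps_without_1 (n + 2)"
  using R_Suc[of n] R_Suc[of "Suc n"] by simp

section \<open>Descents\<close>

text \<open>The increments of 2 at \<open>p\<close> and \<open>p + 1\<close> put both in the range, so that \<open>p + 2\<close> is outside
  it, and \<open>R\<close> drops from \<open>p + 1\<close> to \<open>p + 2\<close>.\<close>

lemma alternating_range_descent:
  assumes "x \<in> range fib_shift" "x + 1 \<notin> range fib_shift" "x + 3 \<notin> range fib_shift"
  shows "reps_without_1 (x + 4) < reps_without_1 (x + 2)"
proof -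
  obtain p where p: "x = fib_shift p" using assms(1) by blast
  have "fib_shift (Suc p) \<noteq> x + 1" using assms(2) by (metis rangeI)
  then have Suc_p: "fib_shift (Suc p) = x + 2" using p fib_shift_Suc_cases[of p] by simp
  have "fib_shift (Suc (Suc p)) \<noteq> x + 3" using assms(3) by (metis rangeI)
  then have Suc_Suc_p: "fib_shift (Suc (Suc p)) = x + 4"
    using Suc_p fib_shift_Suc_cases[of "Suc p"] by simp
  have "p \<in> range fib_shift" "p + 1 \<in> range fib_shift"
    using fib_shift_Suc_not_in_range[of p] fib_shift_Suc_not_in_range[of "Suc p"]
      p Suc_p Suc_Suc_p by auto
  then have "p + 2 \<notin> range fib_shift" by (rule no_three_consecutive_in_range)
  then have "reps_without_1 (p + 2) = 0" by (rule reps_without_1_eq_0_iff[THEN iffD2])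
  moreover have "reps_without_1 p \<noteq> 0"
    using \<open>p \<in> range fib_shift\<close> by (simp only: reps_without_1_eq_0_iff not_not)
  ultimately have "R (p + 2) < R (p + 1)" using R_Suc_le_iff[of p] by linarith
  then show ?thesis
    using reps_without_1_fib_shift[of "Suc p"] reps_without_1_fib_shift[of "Suc (Suc p)"]
    by (simp add: Suc_p Suc_Suc_p)
qed

lemma no_increasing_run_3:
  assumes "1 \<le> n"
  shows "\<not> (R n \<le> R (n + 1) \<and> R (n + 1) \<le> R (n + 2) \<and> R (n + 2) \<le> R (n + 3))"
proof
  assume run: "R n \<le> R (n + 1) \<and> R (n + 1) \<le> R (n + 2) \<and> R (n + 2) \<le> R (n + 3)"
  obtain k where n: "n = k + 1" using assms by (metis add.commute le_Suc_ex)
  let ?I = "range fib_shift" and ?A = reps_without_1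
  have le: "?A k \<le> ?A (k + 2)" "?A (k + 1) \<le> ?A (k + 3)" "?A (k + 2) \<le> ?A (k + 4)"
    using run R_Suc_le_iff[of k] R_Suc_le_iff[of "k + 1"] R_Suc_le_iff[of "k + 2"]
    by (simp_all add: n eval_nat_numeral)
  have down: "i \<notin> ?I" if "?A i \<le> ?A j" "j \<notin> ?I" for i j
    using that reps_without_1_eq_0_iff[of i] reps_without_1_eq_0_iff[of j] by simp
  have "k + 4 \<notin> ?I" if "k + 2 \<in> ?I" "k + 3 \<in> ?I"
    using no_three_consecutive_in_range[of "k + 2"] that by (simp add: eval_nat_numeral)
  then consider "k + 2 \<notin> ?I" | "k + 3 \<notin> ?I" using down[OF le(3)] by blast
  then show False
  proof cases
    case 1
    then have "k \<notin> ?I" by (rule down[OF le(1)])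
    then obtain q where k: "k = Suc (fib_shift q)" by (rule pred_in_range)
    let ?x = "fib_shift q"
    have "?x + 1 \<notin> ?I" "?x + 3 \<notin> ?I"
      using 1 \<open>k \<notin> ?I\<close> k by (simp_all add: eval_nat_numeral)
    from alternating_range_descent[OF rangeI this] have "?A (k + 3) < ?A (k + 1)"
      by (simp add: k eval_nat_numeral)
    then show False using le(2) by simp
  next
    case 2
    then have "k + 1 \<notin> ?I" by (rule down[OF le(2)])
    then have "k \<in> ?I" using adjacent_meets_range[of k] by simp
    from alternating_range_descent[OF this \<open>k + 1 \<notin> ?I\<close> 2] show False using le(3) by simp
  qed
qed

lemma initial_increasing_run: "R 0 \<le> R 1 \<and> R 1 \<le> R 2 \<and> R 2 \<le> R 3"
proof -
  have "1 \<notin> range fib_shift"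
  proof
    assume "1 \<in> range fib_shift"
    then obtain q where q: "fib_shift q = 1" by (metis imageE)
    then have "q = 0" using less_fib_shift[of q] by linarith
    then show False using q fib_shift_0 by simp
  qed
  then have A1: "reps_without_1 1 = 0" by (rule reps_without_1_eq_0_iff[THEN iffD2])
  have A0: "reps_without_1 0 = R 0" using reps_without_1_fib_shift[of 0] fib_shift_0 by simp
  have A2: "reps_without_1 2 = R 1" using reps_without_1_fib_shift[of 1] fib_shift_1 by simp
  have "R 1 = R 0" "R 2 = R 1" "R 2 \<le> R 3"
    using R_Suc[of 0] R_Suc[of 1] R_Suc[of 2] A0 A1 A2 by (simp_all add: eval_nat_numeral)
  then show ?thesis by simp
qed

theorem corollary1p2:
  "(\<exists>n. increasing_run n 3) \<and>
   (\<forall>k. (\<exists>n. increasing_run n k) \<longrightarrow> k \<le> 3) \<and>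
   (R 0 \<le> R 1 \<and> R 1 \<le> R 2 \<and> R 2 \<le> R 3) \<and>
   \<not> (\<exists>n\<ge>1. R n \<le> R (n + 1) \<and> R (n + 1) \<le> R (n + 2) \<and> R (n + 2) \<le> R (n + 3))"
proof (intro conjI)
  have "increasing_run 0 3"
    using initial_increasing_run by (auto simp: increasing_run_def less_Suc_eq eval_nat_numeral)
  then show "\<exists>n. increasing_run n 3" ..
  show "\<forall>k. (\<exists>n. increasing_run n k) \<longrightarrow> k \<le> 3"
  proof (intro allI impI, elim exE)
    fix k n assume run: "increasing_run n k"
    show "k \<le> 3"
    proof (rule ccontr)
      assume "\<not> k \<le> 3"
      then have "R (n + i) \<le> R (n + i + 1)" if "i \<le> 3" for i
        using run that by (simp add: increasing_run_def)
      from this[of 1] this[of 2] this[of 3]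
      \<comment> \<open>Dropping the first term gives a run of four terms that starts at a positive number.\<close>
      show False using no_increasing_run_3[of "n + 1"] by (simp add: eval_nat_numeral)
    qed
  qed
qed (use initial_increasing_run no_increasing_run_3 in blast)+

end
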